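(* Let $(X,d)$ be a separable metric space such that the action $(Iso(X),X)$ is Cauchy-indivisible. If the Ellis semigroup $E$ is a group, then the action $(E,X\cup X_l)$ has a Borel section.
   Context: $Iso(X)$ is the group of surjective isometries of $(X,d)$ with the topology of pointwise convergence; it acts on $X$ by evaluation. For a net $\{z_i\}$ in a space $Z$, "$z_i\to\infty$ in $Z$" means that $\{z_i\}$ has no convergent subnet in $Z$. The action $(Iso(X),X)$ is Cauchy-indivisible if: whenever $\{g_i\}$ is a net in $Iso(X)$ with $g_i\to\infty$ in $Iso(X)$ and $\{g_ix\}$ is a Cauchy net for some $x\in X$, then $\{g_ix\}$ is a Cauchy net for every $x\in X$. $(\widehat X,\widehat d)$ is the completion of $(X,d)$; $\widehat g$ is the extension of $g\in Iso(X)$ to $\widehat X$, and $\widehat{Iso(X)}=\{\widehat g: g\in Iso(X)\}$. $C(\widehat X,\widehat X)$ is the space of continuous selfmaps of $\widehat X$ with the topology of pointwise convergence. $E$ (the Ellis semigroup) is the closure of $\widehat{Iso(X)}$ in $C(\widehat X,\widehat X)$, with the topology of pointwise convergence and composition of maps. Put $H=\{h\in C(\widehat X,\widehat X):$ there is a sequence $\{g_n\}\subset Iso(X)$ with $g_n\to\infty$ in $Iso(X)$ and $\widehat{g_n}\to h$ in $C(\widehat X,\widehat X)\}$ and $X_l=\{hx: h\in H,\ x\in X\}$. The set $X\cup X_l\subset \widehat X$ is $E$-invariant and $E$ acts on it by evaluation. A section of an action $(G,Y)$ is a subset of $Y$ which contains exactly one point from each orbit; a Borel section is a section that is a Borel subset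 of $Y$ (here $Y=X\cup X_l$ with the relative topology from $\widehat X$). *)

theory Defs
  imports "HOL-Analysis.Analysis" "HOL-Algebra.Group"
begin

subsection \<open>Nets\<close>

text \<open>A net is a map on the carrier \<open>D\<close> of a directed preorder \<open>lq\<close>; its values outside
  \<open>D\<close> are irrelevant.\<close>

definition directed :: "'i set \<Rightarrow> ('i \<Rightarrow> 'i \<Rightarrow> bool) \<Rightarrow> bool" where
  "directed D lq \<longleftrightarrow> D \<noteq> {} \<and> reflp_on D lq \<and> transp_on D lq \<and>
     (\<forall>i\<in>D. \<forall>j\<in>D. \<exists>k\<in>D. lq i k \<and> lq j k)"

definition net_converges ::
    "'c topology \<Rightarrow> 'i set \<Rightarrow> ('i \<Rightarrow> 'i \<Rightarrow> bool) \<Rightarrow> ('i \<Rightarrow> 'c) \<Rightarrow> 'c \<Rightarrow> bool" where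
  "net_converges T D lq z l \<longleftrightarrow> l \<in> topspace T \<and>
     (\<forall>U. openin T U \<and> l \<in> U \<longrightarrow> (\<exists>i\<in>D. \<forall>j\<in>D. lq i j \<longrightarrow> z j \<in> U))"

definition cauchy_net ::
    "'i set \<Rightarrow> ('i \<Rightarrow> 'i \<Rightarrow> bool) \<Rightarrow> ('i \<Rightarrow> 'a::metric_space) \<Rightarrow> bool" where
  "cauchy_net D lq z \<longleftrightarrow>
     (\<forall>e>0. \<exists>i\<in>D. \<forall>j\<in>D. \<forall>k\<in>D. lq i j \<and> lq i k \<longrightarrow> dist (z j) (z k) < e)"

text \<open>\<open>subnet_map D lq D' lq' h\<close>: precomposition with \<open>h\<close> turns nets on \<open>D\<close> into
  subnets (in Kelley's sense) on \<open>D'\<close>.\<close>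

definition subnet_map ::
    "'i set \<Rightarrow> ('i \<Rightarrow> 'i \<Rightarrow> bool) \<Rightarrow> 'j set \<Rightarrow> ('j \<Rightarrow> 'j \<Rightarrow> bool) \<Rightarrow> ('j \<Rightarrow> 'i) \<Rightarrow> bool" where
  "subnet_map D lq D' lq' h \<longleftrightarrow> directed D' lq' \<and> h ` D' \<subseteq> D \<and>
     (\<forall>i\<in>D. \<exists>j\<in>D'. \<forall>k\<in>D'. lq' j k \<longrightarrow> lq i (h k))"

text \<open>No convergent subnet. A definition cannot quantify over the index type of the subnet; the
  type \<^typ>\<open>'i \<times> 'c set\<close> is large enough, see \<open>tends_to_infinity_no_subnet\<close> below.\<close>

definition tends_to_infinity ::
    "'c topology \<Rightarrow> 'i set \<Rightarrow> ('i \<Rightarrow> 'i \<Rightarrow> bool) \<Rightarrow> ('i \<Rightarrow> 'c) \<Rightarrow> bool" where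
  "tends_to_infinity T D lq z \<longleftrightarrow>
     \<not> (\<exists>(D' :: ('i \<times> 'c set) set) lq' h l.
          subnet_map D lq D' lq' h \<and> net_converges T D' lq' (z \<circ> h) l)"

lemma convergent_subnet_imp_cluster_point:
  assumes "subnet_map D lq D' lq' h" "net_converges T D' lq' (z \<circ> h) l"
    and "openin T U" "l \<in> U" "i \<in> D"
  shows "\<exists>j\<in>D. lq i j \<and> z j \<in> U"
proof -
  obtain j1 where j1: "j1 \<in> D'" "\<And>k. k \<in> D' \<Longrightarrow> lq' j1 k \<Longrightarrow> lq i (h k)"
    using assms(1,5) unfolding subnet_map_def by blast
  obtain j2 where j2: "j2 \<in> D'" "\<And>k. k \<in> D' \<Longrightarrow> lq' j2 k \<Longrightarrow> z (h k) \<in> U"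
    using assms(2-4) unfolding net_converges_def by auto
  obtain k where "k \<in> D'" "lq' j1 k" "lq' j2 k"
    using assms(1) j1(1) j2(1) unfolding subnet_map_def directed_def by blast
  with j1 j2 assms(1) show ?thesis
    unfolding subnet_map_def by blast
qed

lemma tends_to_infinity_iff_no_cluster_point:
  fixes z :: "'i \<Rightarrow> 'c"
  assumes "directed D lq"
  shows "tends_to_infinity T D lq z \<longleftrightarrow>
    (\<forall>l\<in>topspace T. \<exists>U i. openin T U \<and> l \<in> U \<and> i \<in> D \<and> (\<forall>j\<in>D. lq i j \<longrightarrow> z j \<notin> U))"
    (is "_ \<longleftrightarrow> ?R")
proof
  assume inf: "tends_to_infinity T D lq z"
  show ?R
  proof (rule ballI, rule ccontr)
    fix l assume l: "l \<in> topspace T"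
      and no: "\<not> (\<exists>U i. openin T U \<and> l \<in> U \<and> i \<in> D \<and> (\<forall>j\<in>D. lq i j \<longrightarrow> z j \<notin> U))"
    have cl: "\<exists>j\<in>D. lq i j \<and> z j \<in> U" if "openin T U" "l \<in> U" "i \<in> D" for U i
      using no that by blast
    define D' where "D' = {(i, U). i \<in> D \<and> openin T U \<and> l \<in> U \<and> z i \<in> U}"
    define lq' where "lq' = (\<lambda>p q. lq (fst p) (fst q) \<and> snd q \<subseteq> (snd p :: 'c set))"
    obtain i0 where i0: "i0 \<in> D" using assms unfolding directed_def by blast
    have trans: "lq i j \<Longrightarrow> lq j k \<Longrightarrow> i \<in> D \<Longrightarrow> j \<in> D \<Longrightarrow> k \<in> D \<Longrightarrow> lq i k" for i j k
      using assms unfolding directed_def by (meson transp_onD)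
    have refl: "i \<in> D \<Longrightarrow> lq i i" for i
      using assms unfolding directed_def by (meson reflp_onD)
    have ne: "\<exists>j. (j, topspace T) \<in> D' \<and> lq i j" if "i \<in> D" for i
      using cl[of "topspace T" i] l that unfolding D'_def by auto
    have dir: "directed D' lq'"
      unfolding directed_def
    proof (intro conjI ballI)
      show "D' \<noteq> {}" using ne i0 by blast
      show "reflp_on D' lq'"
        by (rule reflp_onI) (auto simp: D'_def lq'_def refl)
      show "transp_on D' lq'"
        by (rule transp_onI) (auto simp: D'_def lq'_def intro: trans)
      fix p q assume pq: "p \<in> D'" "q \<in> D'"
      then have "fst p \<in> D" "fst q \<in> D" by (auto simp: D'_def)
      then obtain k where k: "k \<in> D" "lq (fst p) k" "lq (fst q) k"
        using assms unfolding directed_def by blast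
      have U: "openin T (snd p \<inter> snd q)" "l \<in> snd p \<inter> snd q"
        using pq by (auto simp: D'_def)
      obtain j where j: "j \<in> D" "lq k j" "z j \<in> snd p \<inter> snd q"
        using cl[OF U k(1)] by blast
      show "\<exists>r\<in>D'. lq' p r \<and> lq' q r"
      proof (intro bexI conjI)
        show "(j, snd p \<inter> snd q) \<in> D'" using U j by (auto simp: D'_def)
        show "lq' p (j, snd p \<inter> snd q)" "lq' q (j, snd p \<inter> snd q)"
          using k j \<open>fst p \<in> D\<close> \<open>fst q \<in> D\<close> trans by (auto simp: lq'_def)
      qed
    qed
    have sub: "subnet_map D lq D' lq' fst"
      unfolding subnet_map_def
    proof (intro conjI ballI dir)
      show "fst ` D' \<subseteq> D" by (auto simp: D'_def)
      fix i assume i: "i \<in> D"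
      then obtain j where j: "(j, topspace T) \<in> D'" "lq i j" using ne by blast
      have "j \<in> D" using j(1) by (simp add: D'_def)
      have "lq i (fst k)" if "k \<in> D'" "lq' (j, topspace T) k" for k
        using that j(2) i \<open>j \<in> D\<close> trans[of i j "fst k"] by (auto simp: D'_def lq'_def)
      then show "\<exists>j\<in>D'. \<forall>k\<in>D'. lq' j k \<longrightarrow> lq i (fst k)"
        using j(1) by blast
    qed
    have conv: "net_converges T D' lq' (z \<circ> fst) l"
      unfolding net_converges_def
    proof (intro conjI l allI impI)
      fix U assume U: "openin T U \<and> l \<in> U"
      then obtain j where j: "j \<in> D" "z j \<in> U" using cl i0 by blast
      have "(j, U) \<in> D'" using U j by (simp add: D'_def)
      moreover have "(z \<circ> fst) k \<in> U" if "k \<in> D'" "lq' (j, U) k" for k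
        using that by (auto simp: D'_def lq'_def)
      ultimately show "\<exists>i\<in>D'. \<forall>k\<in>D'. lq' i k \<longrightarrow> (z \<circ> fst) k \<in> U" by blast
    qed
    show False
      using inf sub conv unfolding tends_to_infinity_def by blast
  qed
next
  assume R: ?R
  show "tends_to_infinity T D lq z"
    unfolding tends_to_infinity_def
  proof safe
    fix D' :: "('i \<times> 'c set) set" and lq' h l
    assume *: "subnet_map D lq D' lq' h" "net_converges T D' lq' (z \<circ> h) l"
    then have "l \<in> topspace T" by (simp add: net_converges_def)
    with R obtain U i where U: "openin T U" "l \<in> U" "i \<in> D" "\<forall>j\<in>D. lq i j \<longrightarrow> z j \<notin> U"
      by blast
    from convergent_subnet_imp_cluster_point[OF * U(1-3)] U(4) show False by blast
  qed
qed

lemma tends_to_infinity_no_subnet: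
  fixes D' :: "'j set"
  assumes "directed D lq" "tends_to_infinity T D lq z" "subnet_map D lq D' lq' h"
  shows "\<not> net_converges T D' lq' (z \<circ> h) l"
proof
  assume *: "net_converges T D' lq' (z \<circ> h) l"
  then have "l \<in> topspace T" by (simp add: net_converges_def)
  with assms(2) obtain U i where U: "openin T U" "l \<in> U" "i \<in> D" "\<forall>j\<in>D. lq i j \<longrightarrow> z j \<notin> U"
    unfolding tends_to_infinity_iff_no_cluster_point[OF assms(1)] by blast
  from convergent_subnet_imp_cluster_point[OF assms(3) * U(1-3)] U(4) show False by blast
qed


subsection \<open>The isometry group and Cauchy-indivisibility\<close>

text \<open>The library topology on a function type is the product topology, so \<open>top_of_set\<close> of a
  set of functions is that set with the topology of pointwise convergence.\<close>

definition Iso :: "('a::metric_space \<Rightarrow> 'a) set" where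
  "Iso = {g. (\<forall>x y. dist (g x) (g y) = dist x y) \<and> surj g}"

text \<open>Again the index type is fixed, and \<open>cauchy_indivisible_net\<close> below shows that this is no
  restriction.\<close>

definition cauchy_indivisible :: "('a::metric_space \<Rightarrow> 'a) set \<Rightarrow> bool" where
  "cauchy_indivisible G \<longleftrightarrow>
     (\<forall>(D :: (('a \<Rightarrow> 'a) \<times> ('a \<Rightarrow> 'a) set) set) lq g.
        directed D lq \<and> g ` D \<subseteq> G \<and> tends_to_infinity (top_of_set G) D lq g \<and>
        (\<exists>x. cauchy_net D lq (\<lambda>i. g i x)) \<longrightarrow>
        (\<forall>x. cauchy_net D lq (\<lambda>i. g i x)))"

lemma cauchy_indivisible_net:
  fixes D :: "'i set" and g :: "'i \<Rightarrow> 'a::metric_space \<Rightarrow> 'a"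
  assumes ind: "cauchy_indivisible G"
    and dir: "directed D lq" and gG: "g ` D \<subseteq> G"
    and inf: "tends_to_infinity (top_of_set G) D lq g"
    and cau: "cauchy_net D lq (\<lambda>i. g i x)"
  shows "cauchy_net D lq (\<lambda>i. g i y)"
proof -
  define tail where "tail i = g ` {j \<in> D. lq i j}" for i
  define D' where "D' = {(f, A). \<exists>i\<in>D. A = tail i \<and> f \<in> A}"
  define lq' where "lq' = 
      (\<lambda>(p :: ('a \<Rightarrow> 'a) \<times> ('a \<Rightarrow> 'a) set) (q :: ('a \<Rightarrow> 'a) \<times> ('a \<Rightarrow> 'a) set).
         snd q \<subseteq> snd p)"
  have trans: "lq i j \<Longrightarrow> lq j k \<Longrightarrow> i \<in> D \<Longrightarrow> j \<in> D \<Longrightarrow> k \<in> D \<Longrightarrow> lq i k" for i j k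
    using dir unfolding directed_def by (meson transp_onD)
  have refl: "i \<in> D \<Longrightarrow> lq i i" for i
    using dir unfolding directed_def by (meson reflp_onD)
  have mem: "(g i, tail i) \<in> D'" if "i \<in> D" for i
    using that refl unfolding D'_def tail_def by blast
  have tail_mono: "tail j \<subseteq> tail i" if "i \<in> D" "j \<in> D" "lq i j" for i j
    using that trans unfolding tail_def by blast
  have dir': "directed D' lq'"
    unfolding directed_def
  proof (intro conjI ballI)
    show "D' \<noteq> {}" using mem dir unfolding directed_def by blast
    show "reflp_on D' lq'" by (rule reflp_onI) (auto simp: lq'_def)
    show "transp_on D' lq'" by (rule transp_onI) (auto simp: lq'_def)
    fix p q assume "p \<in> D'" "q \<in> D'"
    then obtain i j where ij: "i \<in> D" "j \<in> D" "snd p = tail i" "snd q = tail j"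
      unfolding D'_def by auto
    then obtain k where "k \<in> D" "lq i k" "lq j k"
      using dir unfolding directed_def by blast
    with ij show "\<exists>r\<in>D'. lq' p r \<and> lq' q r"
      using tail_mono mem by (intro bexI[of _ "(g k, tail k)"]) (auto simp: lq'_def)
  qed
  have eventually: "(\<exists>p\<in>D'. \<forall>q\<in>D'. lq' p q \<longrightarrow> P (fst q)) \<longleftrightarrow> (\<exists>i\<in>D. \<forall>j\<in>D. lq i j \<longrightarrow> P (g j))" for P
  proof
    assume "\<exists>p\<in>D'. \<forall>q\<in>D'. lq' p q \<longrightarrow> P (fst q)"
    then obtain p where p: "p \<in> D'" "\<And>q. q \<in> D' \<Longrightarrow> lq' p q \<Longrightarrow> P (fst q)" by blast
    then obtain i where i: "i \<in> D" "snd p = tail i" unfolding D'_def by auto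
    have "P (g j)" if "j \<in> D" "lq i j" for j
      using p(2)[OF mem[OF that(1)]] tail_mono[OF i(1) that] i(2) by (simp add: lq'_def)
    then show "\<exists>i\<in>D. \<forall>j\<in>D. lq i j \<longrightarrow> P (g j)" using i(1) by blast
  next
    assume "\<exists>i\<in>D. \<forall>j\<in>D. lq i j \<longrightarrow> P (g j)"
    then obtain i where i: "i \<in> D" "\<And>j. j \<in> D \<Longrightarrow> lq i j \<Longrightarrow> P (g j)" by blast
    have "P (fst q)" if "q \<in> D'" "lq' (g i, tail i) q" for q
    proof -
      have "fst q \<in> tail i" using that unfolding D'_def lq'_def by auto
      then show ?thesis using i(2) unfolding tail_def by auto
    qed
    then show "\<exists>p\<in>D'. \<forall>q\<in>D'. lq' p q \<longrightarrow> P (fst q)" using mem[OF i(1)] by blast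
  qed
  have cauchy_iff: "cauchy_net D' lq' (\<lambda>p. fst p u) \<longleftrightarrow> cauchy_net D lq (\<lambda>i. g i u)" for u
  proof -
    have "(\<exists>p\<in>D'. \<forall>q\<in>D'. \<forall>r\<in>D'. lq' p q \<and> lq' p r \<longrightarrow> dist (fst q u) (fst r u) < e) \<longleftrightarrow>
          (\<exists>i\<in>D. \<forall>j\<in>D. \<forall>k\<in>D. lq i j \<and> lq i k \<longrightarrow> dist (g j u) (g k u) < e)" for e
    proof
      assume "\<exists>p\<in>D'. \<forall>q\<in>D'. \<forall>r\<in>D'. lq' p q \<and> lq' p r \<longrightarrow> dist (fst q u) (fst r u) < e"
      then obtain p where p: "p \<in> D'"
        "\<And>q r. q \<in> D' \<Longrightarrow> r \<in> D' \<Longrightarrow> lq' p q \<Longrightarrow> lq' p r \<Longrightarrow> dist (fst q u) (fst r u) < e" by blast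
      then obtain i where i: "i \<in> D" "snd p = tail i" unfolding D'_def by auto
      have "dist (g j u) (g k u) < e" if "j \<in> D" "k \<in> D" "lq i j" "lq i k" for j k
        using p(2)[OF mem[OF that(1)] mem[OF that(2)]] tail_mono[OF i(1)] that i(2)
        by (simp add: lq'_def)
      then show "\<exists>i\<in>D. \<forall>j\<in>D. \<forall>k\<in>D. lq i j \<and> lq i k \<longrightarrow> dist (g j u) (g k u) < e"
        using i(1) by blast
    next
      assume "\<exists>i\<in>D. \<forall>j\<in>D. \<forall>k\<in>D. lq i j \<and> lq i k \<longrightarrow> dist (g j u) (g k u) < e"
      then obtain i where i: "i \<in> D"
        "\<And>j k. j \<in> D \<Longrightarrow> k \<in> D \<Longrightarrow> lq i j \<Longrightarrow> lq i k \<Longrightarrow> dist (g j u) (g k u) < e" by blast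
      have "dist (fst q u) (fst r u) < e"
        if "q \<in> D'" "r \<in> D'" "lq' (g i, tail i) q" "lq' (g i, tail i) r" for q r
      proof -
        have "fst q \<in> tail i" "fst r \<in> tail i" using that unfolding D'_def lq'_def by auto
        then show ?thesis using i(2) unfolding tail_def by auto
      qed
      then show "\<exists>p\<in>D'. \<forall>q\<in>D'. \<forall>r\<in>D'. lq' p q \<and> lq' p r \<longrightarrow> dist (fst q u) (fst r u) < e"
        using mem[OF i(1)] by blast
    qed
    then show ?thesis unfolding cauchy_net_def by simp
  qed
  have inf': "tends_to_infinity (top_of_set G) D' lq' fst"
    unfolding tends_to_infinity_iff_no_cluster_point[OF dir']
  proof
    fix l assume "l \<in> topspace (top_of_set G)"
    then obtain U i where U: "openin (top_of_set G) U" "l \<in> U"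
      and "i \<in> D" "\<forall>j\<in>D. lq i j \<longrightarrow> g j \<notin> U"
      using inf unfolding tends_to_infinity_iff_no_cluster_point[OF dir] by blast
    then have "\<exists>p\<in>D'. \<forall>q\<in>D'. lq' p q \<longrightarrow> fst q \<notin> U"
      using eventually[of "\<lambda>f. f \<notin> U"] by blast
    with U show "\<exists>U p. openin (top_of_set G) U \<and> l \<in> U \<and> p \<in> D' \<and>
        (\<forall>q\<in>D'. lq' p q \<longrightarrow> fst q \<notin> U)" by blast
  qed
  have "fst ` D' \<subseteq> G"
    using gG unfolding D'_def tail_def by auto
  then have "cauchy_net D' lq' (\<lambda>p. fst p y)"
    using ind[unfolded cauchy_indivisible_def, rule_format, of D' lq' fst y]
      dir' inf' cauchy_iff cau by blast
  then show ?thesis by (simp add: cauchy_iff)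
qed


subsection \<open>Completion and Ellis semigroup\<close>

text \<open>A completion of \<^typ>\<open>'a\<close> is presented as a complete space \<^typ>\<open>'b\<close> together with an
  isometric embedding \<open>\<iota>\<close> with dense range, through which \<open>X\<close> is identified with
  \<open>range \<iota>\<close>.\<close>

definition is_completion :: "('a::metric_space \<Rightarrow> 'b::complete_space) \<Rightarrow> bool" where
  "is_completion \<iota> \<longleftrightarrow> (\<forall>x y. dist (\<iota> x) (\<iota> y) = dist x y) \<and> closure (range \<iota>) = UNIV"

definition completion_ext :: "('a::metric_space \<Rightarrow> 'b::complete_space) \<Rightarrow> ('a \<Rightarrow> 'a) \<Rightarrow> 'b \<Rightarrow> 'b" where
  "completion_ext \<iota> g = (THE h. continuous_on UNIV h \<and> (\<forall>x. h (\<iota> x) = \<iota> (g x)))"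

lemma completion_ext_unique_existence:
  assumes "is_completion \<iota>" "g \<in> Iso"
  shows "\<exists>!h. continuous_on UNIV h \<and> (\<forall>x. h (\<iota> x) = \<iota> (g x))"
proof -
  have iso: "dist (\<iota> x) (\<iota> y) = dist x y" for x y
    using assms(1) unfolding is_completion_def by auto
  have cl: "closure (range \<iota>) = UNIV"
    using assms(1) unfolding is_completion_def by auto
  have inj: "inj \<iota>"
    by (rule injI) (metis iso dist_eq_0_iff)
  have giso: "dist (g x) (g y) = dist x y" for x y
    using assms(2) unfolding Iso_def by auto
  define f where "f = (\<lambda>u. \<iota> (g (inv_into UNIV \<iota> u)))"
  have f: "f (\<iota> x) = \<iota> (g x)" for x
    by (simp add: f_def inj)
  have "uniformly_continuous_on (range \<iota>) f"
    unfolding uniformly_continuous_on_def by (auto simp: f iso giso)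
  then obtain h where h: "uniformly_continuous_on (closure (range \<iota>)) h"
    "\<And>u. u \<in> range \<iota> \<Longrightarrow> f u = h u"
    using uniformly_continuous_on_extension_on_closure by metis
  show ?thesis
  proof (rule ex1I[of _ h])
    show "continuous_on UNIV h \<and> (\<forall>x. h (\<iota> x) = \<iota> (g x))"
      using uniformly_continuous_imp_continuous[OF h(1)] h(2) f by (simp add: cl)
    fix k assume k: "continuous_on UNIV k \<and> (\<forall>x. k (\<iota> x) = \<iota> (g x))"
    have "closed {u. k u = h u}"
      using k uniformly_continuous_imp_continuous[OF h(1)] by (intro closed_Collect_eq) (simp_all add: cl)
    moreover have "range \<iota> \<subseteq> {u. k u = h u}"
    proof safe
      fix x show "k (\<iota> x) = h (\<iota> x)" using k h(2)[of "\<iota> x"] f[of x] by simp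
    qed
    ultimately have "closure (range \<iota>) \<subseteq> {u. k u = h u}"
      by (rule closure_minimal[rotated])
    then show "k = h" using cl by auto
  qed
qed

lemma completion_ext_props:
  assumes "is_completion \<iota>" "g \<in> Iso"
  shows "continuous_on UNIV (completion_ext \<iota> g)" "completion_ext \<iota> g (\<iota> x) = \<iota> (g x)"
  using theI'[OF completion_ext_unique_existence[OF assms]] unfolding completion_ext_def by blast+

definition C_top :: "('b::topological_space \<Rightarrow> 'b) topology" where
  "C_top = top_of_set {h. continuous_on UNIV h}"

definition Ellis :: "('a::metric_space \<Rightarrow> 'b::complete_space) \<Rightarrow> ('b \<Rightarrow> 'b) set" where
  "Ellis \<iota> = Abstract_Topology.closure_of C_top (completion_ext \<iota> ` Iso)"

text \<open>The identity lies in the Ellis semigroup, so it is the only possible neutral element.\<close>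

definition Ellis_monoid :: "('a::metric_space \<Rightarrow> 'b::complete_space) \<Rightarrow> ('b \<Rightarrow> 'b) monoid" where
  "Ellis_monoid \<iota> = \<lparr>carrier = Ellis \<iota>, mult = (\<circ>), one = id\<rparr>"

definition limit_maps :: "('a::metric_space \<Rightarrow> 'b::complete_space) \<Rightarrow> ('b \<Rightarrow> 'b) set" where
  "limit_maps \<iota> = {h. \<exists>g :: nat \<Rightarrow> 'a \<Rightarrow> 'a.
     range g \<subseteq> Iso \<and> tends_to_infinity (top_of_set Iso) UNIV (\<le>) g \<and>
     limitin C_top (\<lambda>n. completion_ext \<iota> (g n)) h sequentially}"

definition limit_points :: "('a::metric_space \<Rightarrow> 'b::complete_space) \<Rightarrow> 'b set" where
  "limit_points \<iota> = {h (\<iota> x) | h x. h \<in> limit_maps \<iota>}"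


subsection \<open>Borel sections\<close>

definition is_section :: "('b \<Rightarrow> 'b) set \<Rightarrow> 'b set \<Rightarrow> 'b set \<Rightarrow> bool" where
  "is_section G Y S \<longleftrightarrow> S \<subseteq> Y \<and> (\<forall>y\<in>Y. \<exists>!s. s \<in> S \<and> s \<in> {h y | h. h \<in> G})"

definition is_borel_section ::
    "('b::topological_space \<Rightarrow> 'b) set \<Rightarrow> 'b set \<Rightarrow> 'b set \<Rightarrow> bool" where
  "is_borel_section G Y S \<longleftrightarrow>
     is_section G Y S \<and> S \<in> sigma_sets Y {U. openin (top_of_set Y) U}"

end

theory Submission
  imports Defs
begin

text \<open>For \<open>x \<in> X\<close> the \<open>E\<close>-orbit of \<open>x\<close> is the closure of its \<open>Iso(X)\<close>-orbit in the completion: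
  a sequence \<open>g\<^sub>n x\<close> that converges in the completion is Cauchy, so either \<open>g\<^sub>n\<close> clusters at some
  isometry \<open>g\<close> and the limit is \<open>g x\<close>, or \<open>g\<^sub>n\<close> tends to infinity and, by Cauchy-indivisibility,
  \<open>g\<^sub>n\<close> converges pointwise to some \<open>h \<in> H\<close>. Hence \<open>X \<union> X\<^sub>l = E X\<close>, and, \<open>E\<close> being a group, all its
  orbits are closed in the completion. A continuous group action with complete orbits on a separable
  space has a Borel section: each orbit selects, from a countable dense set, a rapidly convergent
  sequence of points approaching it, whose limit is the chosen point of the orbit.\<close>

subsection \<open>Borel sections for actions with complete orbits\<close>

lemma Cauchy_if_dist_Suc_le_geometric:
  fixes z :: "nat \<Rightarrow> 'b::metric_space"
  assumes step: "\<And>n. dist (z (Suc n)) (z n) \<le> c / 2 ^ n"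
  shows "Cauchy z"
proof -
  \<comment> \<open>The right-hand side is the exact value of the geometric sum of
    \<open>c / 2 ^ i\<close> over \<open>n \<le> i < n + k\<close>, so the induction step is an
    identity after the triangle inequality.\<close>
  have bound: "dist (z (n + k)) (z n) \<le> 2 * c / 2 ^ n - 2 * c / 2 ^ (n + k)" for n k
  proof (induction k)
    case (Suc k)
    have "dist (z (n + Suc k)) (z n) \<le> dist (z (Suc (n + k))) (z (n + k)) + dist (z (n + k)) (z n)"
      using dist_triangle by simp
    also have "\<dots> \<le> c / 2 ^ (n + k) + (2 * c / 2 ^ n - 2 * c / 2 ^ (n + k))"
      using step Suc by (intro add_mono)
    also have "\<dots> = 2 * c / 2 ^ n - 2 * c / 2 ^ (n + Suc k)"
      by (simp add: field_simps)
    finally show ?case .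
  qed simp
  have "0 \<le> c"
    using step[of 0] zero_le_dist[of "z (Suc 0)" "z 0"] by (simp del: zero_le_dist)
  have le: "dist (z m) (z n) \<le> 2 * c / 2 ^ n" if "n \<le> m" for m n
  proof -
    have "0 \<le> 2 * c / 2 ^ m" using \<open>0 \<le> c\<close> by simp
    then show ?thesis using bound[of n "m - n"] that by simp
  qed
  have "(\<lambda>n. 2 * c * (1 / 2) ^ n) \<longlonglongrightarrow> 2 * c * 0"
    by (intro tendsto_intros LIMSEQ_realpow_zero) auto
  then have lim: "(\<lambda>n. 2 * c / 2 ^ n) \<longlonglongrightarrow> 0"
    by (simp add: power_divide)
  show ?thesis
    unfolding Cauchy_altdef
  proof (intro allI impI)
    fix e :: real assume "0 < e"
    then obtain N where N: "\<And>n. N \<le> n \<Longrightarrow> 2 * c / 2 ^ n < e"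
      using order_tendstoD(2)[OF lim] unfolding eventually_sequentially by blast
    show "\<exists>M. \<forall>m\<ge>M. \<forall>n>m. dist (z m) (z n) < e"
    proof (intro exI allI impI)
      fix m n assume "N \<le> m" "m < n"
      then show "dist (z m) (z n) < e"
        using le[of m n] N[of m] by (simp add: dist_commute)
    qed
  qed
qed

section \<open>Approaching a set along a dense sequence\<close>

text \<open>Taking the least admissible index makes the choice canonical: it depends on the set
  \<open>A\<close> alone, so all points of an orbit share it, and it can be measured one index at a
  time. The bound \<open>1\<close> at stage 0 is \<open>1 / 2 ^ 0\<close>.\<close>

primrec approx_index :: "(nat \<Rightarrow> 'b::metric_space) \<Rightarrow> 'b set \<Rightarrow> nat \<Rightarrow> nat" where
  "approx_index q A 0 = (LEAST k. \<exists>a\<in>A. dist (q k) a < 1)"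
| "approx_index q A (Suc n) = (LEAST k. (\<exists>a\<in>A. dist (q k) a < 1 / 2 ^ Suc n) \<and>
      dist (q k) (q (approx_index q A n)) < 2 / 2 ^ n)"

context
  fixes q :: "nat \<Rightarrow> 'b::metric_space" and A :: "'b set"
  assumes nonempty: "A \<noteq> {}" and dense: "A \<subseteq> closure (range q)"
begin

lemma ex_close: "a \<in> A \<Longrightarrow> 0 < e \<Longrightarrow> \<exists>k. dist (q k) a < e"
  using dense closure_approachable[of a "range q"] by fastforce

text \<open>Guarantees that the \<open>LEAST\<close> in the recursion has a candidate: approximate
  the witness \<open>a\<close> of stage \<open>n\<close> twice as well; the distance to the old
  point is then below 3/2 times \<open>1 / 2 ^ n\<close>.\<close>

lemma ex_next_index:
  assumes "\<exists>a\<in>A. dist (q j) a < 1 / 2 ^ n"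
  shows "\<exists>k. (\<exists>a\<in>A. dist (q k) a < 1 / 2 ^ Suc n) \<and> dist (q k) (q j) < 2 / 2 ^ n"
proof -
  obtain a where a: "a \<in> A" "dist (q j) a < 1 / 2 ^ n" using assms by blast
  obtain k where k: "dist (q k) a < 1 / 2 ^ Suc n"
    using ex_close[OF a(1), of "1 / 2 ^ Suc n"] by auto
  have "dist (q k) (q j) \<le> dist (q k) a + dist (q j) a" by (rule dist_triangle2)
  also have "\<dots> < 1 / 2 ^ Suc n + 1 / 2 ^ n" using a k by simp
  also have "\<dots> \<le> 2 / 2 ^ n" by (simp add: field_simps)
  finally show ?thesis using a k by blast
qed

lemma approx_index_near: "\<exists>a\<in>A. dist (q (approx_index q A n)) a < 1 / 2 ^ n"
proof (induction n)
  case 0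
  obtain a where a: "a \<in> A" using nonempty by blast
  have "\<exists>k. \<exists>a\<in>A. dist (q k) a < 1" using ex_close[OF a, of 1] a by auto
  from LeastI_ex[OF this] show ?case by simp
next
  case (Suc n)
  from LeastI_ex[OF ex_next_index[OF Suc]] show ?case by simp
qed

lemma approx_index_step:
  "dist (q (approx_index q A (Suc n))) (q (approx_index q A n)) < 2 / 2 ^ n"
  using LeastI_ex[OF ex_next_index[OF approx_index_near[of n]]] by simp

text \<open>The points \<open>q k\<close> need not lie in \<open>A\<close>, so completeness is
  applied to nearby points of \<open>A\<close> instead. These have geometric steps too, and their
  limit is also that of the approximants because the gaps vanish.\<close>

lemma approx_index_limit:
  assumes "complete A"
  obtains a where "a \<in> A" "(\<lambda>n. q (approx_index q A n)) \<longlonglongrightarrow> a"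
proof -
  define z where "z n = q (approx_index q A n)" for n
  have "\<exists>a. \<forall>n. a n \<in> A \<and> dist (z n) (a n) < 1 / 2 ^ n"
    using approx_index_near unfolding z_def by metis
  then obtain a where a: "\<And>n. a n \<in> A" "\<And>n. dist (z n) (a n) < 1 / 2 ^ n" by blast
  \<comment> \<open>In units of \<open>1 / 2 ^ n\<close> the three legs are at most 1/2, 2 and 1, in
    total 7/2.\<close>
  have "dist (a (Suc n)) (a n) \<le> 4 / 2 ^ n" for n
  proof -
    have "dist (a (Suc n)) (a n) \<le> dist (z (Suc n)) (a (Suc n)) + dist (z (Suc n)) (z n) + dist (z n) (a n)"
      by (smt (verit) dist_commute dist_triangle)
    also have "\<dots> \<le> 1 / 2 ^ Suc n + 2 / 2 ^ n + 1 / 2 ^ n"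
      using a(2)[of n] a(2)[of "Suc n"] approx_index_step[of n] unfolding z_def by linarith
    also have "\<dots> \<le> 4 / 2 ^ n" by (simp add: field_simps)
    finally show ?thesis .
  qed
  then have "Cauchy a" by (rule Cauchy_if_dist_Suc_le_geometric)
  then obtain l where l: "l \<in> A" "a \<longlonglongrightarrow> l"
    using assms a(1) unfolding complete_def by blast
  have "(\<lambda>n. dist (z n) (a n)) \<longlonglongrightarrow> 0"
  proof (rule tendsto_sandwich[OF _ _ tendsto_const])
    have "(\<lambda>n. (1 / 2 :: real) ^ n) \<longlonglongrightarrow> 0" by (rule LIMSEQ_realpow_zero) auto
    then show "(\<lambda>n. 1 / 2 ^ n :: real) \<longlonglongrightarrow> 0" by (simp add: power_divide)
  qed (auto intro: always_eventually less_imp_le a(2))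
  moreover have "(\<lambda>n. dist (a n) l) \<longlonglongrightarrow> 0"
    using l(2) by (simp only: tendsto_dist_iff[symmetric])
  ultimately have sum: "(\<lambda>n. dist (z n) (a n) + dist (a n) l) \<longlonglongrightarrow> 0"
    using tendsto_add_zero by blast
  have "(\<lambda>n. dist (z n) l) \<longlonglongrightarrow> 0"
    by (rule tendsto_sandwich[OF _ _ tendsto_const sum]) (auto intro: always_eventually dist_triangle)
  then have "z \<longlonglongrightarrow> l"
    by (simp only: tendsto_dist_iff[symmetric])
  with l(1) show ?thesis using that unfolding z_def by blast
qed

end

section \<open>Construction and measurability of the section\<close>

text \<open>The selected limit depends on the orbit only, which makes it a section; the indices take
  countably many values and are found by open conditions, which makes it Borel. The group structure
  enters through \<open>orb_eq\<close>.\<close>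

lemma ex_borel_section:
  fixes G :: "('b::metric_space \<Rightarrow> 'b) set" and q :: "nat \<Rightarrow> 'b"
  defines "orb \<equiv> \<lambda>y. {h y | h. h \<in> G}"
  assumes cont: "\<And>f. f \<in> G \<Longrightarrow> continuous_on Y f"
    and inv: "\<And>f y. f \<in> G \<Longrightarrow> y \<in> Y \<Longrightarrow> f y \<in> Y"
    and id: "id \<in> G"
    and orb_eq: "\<And>f y. f \<in> G \<Longrightarrow> y \<in> Y \<Longrightarrow> orb (f y) = orb y"
    and complete: "\<And>y. y \<in> Y \<Longrightarrow> complete (orb y)"
    and dense: "Y \<subseteq> closure (range q)"
  shows "\<exists>S. is_borel_section G Y S"
proof -
  define idx where "idx y = approx_index q (orb y)" for y
  \<comment> \<open>The section is described as a fixed-point set, the points that equal the limit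
    selected for their own orbit, rather than as an image, so that it is given by conditions on
    \<open>y\<close> itself.\<close>
  define S where "S = {y \<in> Y. (\<lambda>n. q (idx y n)) \<longlonglongrightarrow> y}"
  have limit: "\<exists>a\<in>orb y. (\<lambda>n. q (idx y n)) \<longlonglongrightarrow> a" if "y \<in> Y" for y
  proof -
    have "orb y \<noteq> {}" using id by (auto simp: orb_def)
    moreover have "orb y \<subseteq> closure (range q)" using inv that dense by (auto simp: orb_def)
    ultimately show ?thesis
      using approx_index_limit[OF _ _ complete[OF that]] unfolding idx_def by metis
  qed
  have "is_section G Y S"
    unfolding is_section_def
  proof (intro conjI ballI)
    show "S \<subseteq> Y" by (auto simp: S_def)
    fix y assume y: "y \<in> Y"
    have orbD: "a \<in> Y" "orb a = orb y" if "a \<in> orb y" for a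
    proof -
      obtain f where "f \<in> G" "a = f y" using \<open>a \<in> orb y\<close> unfolding orb_def by blast
      then show "a \<in> Y" "orb a = orb y" using y inv orb_eq by simp_all
    qed
    \<comment> \<open>All points of the orbit have the same index sequence, so uniqueness of limits
      becomes uniqueness of the section point.\<close>
    then have S_iff: "a \<in> S \<longleftrightarrow> (\<lambda>n. q (idx y n)) \<longlonglongrightarrow> a" if "a \<in> orb y" for a
      using that by (simp add: S_def idx_def)
    obtain a where "a \<in> orb y" "(\<lambda>n. q (idx y n)) \<longlonglongrightarrow> a" using limit[OF y] by blast
    then have "\<exists>!s. s \<in> S \<and> s \<in> orb y"
      using S_iff LIMSEQ_unique by blast
    then show "\<exists>!s. s \<in> S \<and> s \<in> {h y | h. h \<in> G}" by (simp add: orb_def)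
  qed
  moreover have "S \<in> sigma_sets Y {U. openin (top_of_set Y) U}"
  proof -
    define M where "M = sigma Y {U. openin (top_of_set Y) U}"
    have "{U. openin (top_of_set Y) U} \<subseteq> Pow Y"
      using openin_subset by fastforce
    then have space: "space M = Y" and sets: "sets M = sigma_sets Y {U. openin (top_of_set Y) U}"
      by (simp_all add: M_def)
    have open_M: "U \<in> sets M" if "openin (top_of_set Y) U" for U
      using that unfolding sets by (intro sigma_sets.Basic) simp
    \<comment> \<open>The existential over the possibly uncountable orbit is harmless: it is a union
      of preimages of a ball under continuous maps, hence open.\<close>
    have near_open: "openin (top_of_set Y) {y \<in> Y. \<exists>a\<in>orb y. dist c a < r}" for c r
    proof -
      have "{y \<in> Y. \<exists>a\<in>orb y. dist c a < r} = (\<Union>f\<in>G. Y \<inter> f -` ball c r)"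
        by (auto simp: orb_def)
      moreover have "openin (top_of_set Y) (\<Union>f\<in>G. Y \<inter> f -` ball c r)"
        using cont continuous_openin_preimage_gen by blast
      ultimately show ?thesis by simp
    qed
    have near [measurable]: "Measurable.pred M (\<lambda>y. \<exists>a\<in>orb y. dist c a < r)" for c r
      using open_M[OF near_open[of c r]] by (simp add: pred_def space)
    have dist [measurable]: "Measurable.pred M (\<lambda>y. dist c y < r)" for c r
    proof -
      have "openin (top_of_set Y) (Y \<inter> ball c r)" by (simp add: openin_open_Int)
      moreover have "Y \<inter> ball c r = {y \<in> Y. dist c y < r}" by auto
      ultimately show ?thesis using open_M by (simp add: pred_def space)
    qed
    have idx [measurable]: "(\<lambda>y. idx y n) \<in> M \<rightarrow>\<^sub>M count_space UNIV" for n
    proof (induction n)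
      case 0
      show ?case by (simp add: idx_def)
    next
      case (Suc n)
      note [measurable] = Suc
      \<comment> \<open>For fixed \<open>k\<close> the first condition is open in \<open>y\<close>,
        and the second depends on \<open>y\<close> only through the previous index, measurable by
        induction.\<close>
      have "(\<lambda>y. LEAST k. (\<exists>a\<in>orb y. dist (q k) a < 1 / 2 ^ Suc n) \<and>
          dist (q k) (q (idx y n)) < 2 / 2 ^ n) \<in> M \<rightarrow>\<^sub>M count_space UNIV"
        by measurable
      then show ?case by (simp add: idx_def)
    qed
    \<comment> \<open>Split according to the countably many values of the index; for each fixed
      value the condition defines a relatively open ball.\<close>
    have "Measurable.pred M (\<lambda>y. dist (q (idx y n)) y < r)" for n r
      by (rule measurable_compose_countable[OF dist idx])
    then have "Measurable.pred M (\<lambda>y. \<forall>m. \<exists>N. \<forall>n\<in>{N..}. dist (q (idx y n)) y < inverse (Suc m))"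
      by measurable
    \<comment> \<open>Convergence is written with quantifiers over naturals only, hence with
      countable unions and intersections.\<close>
    moreover have "S = {y \<in> Y. \<forall>m. \<exists>N. \<forall>n\<in>{N..}. dist (q (idx y n)) y < inverse (Suc m)}"
    proof -
      have "(z \<longlonglongrightarrow> y) \<longleftrightarrow> (\<forall>m. \<exists>N. \<forall>n\<in>{N..}. dist (z n) y < inverse (Suc m))"
        for z :: "nat \<Rightarrow> 'b" and y
        unfolding lim_sequentially
        by (meson atLeast_iff inverse_Suc reals_Archimedean order.strict_trans)
      then show ?thesis by (simp add: S_def)
    qed
    ultimately have "S \<in> sets M" by (simp add: pred_def space)
    then show ?thesis by (simp add: sets)
  qed
  ultimately show ?thesis unfolding is_borel_section_def by blast
qed

subsection \<open>Orbits of the Ellis semigroup\<close>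

text \<open>Both sides are continuous in the pair \<open>(u, v)\<close> and agree on
  \<open>range \<iota> \<times> range \<iota>\<close>, which is dense in the product.\<close>

lemma completion_ext_isometric:
  assumes "is_completion \<iota>" "g \<in> Iso"
  shows "dist (completion_ext \<iota> g u) (completion_ext \<iota> g v) = dist u v"
proof -
  note cont = completion_ext_props(1)[OF assms]
  have cont': "continuous_on UNIV (\<lambda>p. completion_ext \<iota> g (f p))"
    if "continuous_on UNIV f" for f :: "'b \<times> 'b \<Rightarrow> 'b"
    by (rule continuous_on_compose2[OF cont that]) simp
  have "closed {p. dist (completion_ext \<iota> g (fst p)) (completion_ext \<iota> g (snd p)) = dist (fst p) (snd p)}"
    by (intro closed_Collect_eq continuous_intros cont')
  moreover have "range \<iota> \<times> range \<iota> \<subseteq>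
      {p. dist (completion_ext \<iota> g (fst p)) (completion_ext \<iota> g (snd p)) = dist (fst p) (snd p)}"
    using assms by (auto simp: completion_ext_props(2)[OF assms] is_completion_def Iso_def)
  ultimately have "closure (range \<iota> \<times> range \<iota>) \<subseteq>
      {p. dist (completion_ext \<iota> g (fst p)) (completion_ext \<iota> g (snd p)) = dist (fst p) (snd p)}"
    by (rule closure_minimal[rotated])
  then have "(u, v) \<in> {p. dist (completion_ext \<iota> g (fst p)) (completion_ext \<iota> g (snd p)) = dist (fst p) (snd p)}"
    using assms(1) by (simp add: closure_Times is_completion_def subset_iff)
  then show ?thesis by simp
qed

lemma Ellis_subset_closure: "Ellis \<iota> \<subseteq> closure (completion_ext \<iota> ` Iso)"
  unfolding Ellis_def C_top_def by (metis closure_of_subtopology_subset euclidean_closure_of)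

lemma Ellis_continuous: "f \<in> Ellis \<iota> \<Longrightarrow> continuous_on UNIV f"
  unfolding Ellis_def C_top_def by (auto simp: closure_of_subtopology)

lemma completion_ext_in_Ellis:
  assumes "is_completion \<iota>" "g \<in> Iso"
  shows "completion_ext \<iota> g \<in> Ellis \<iota>"
  unfolding Ellis_def
  using assms completion_ext_props(1)[OF assms(1)]
  by (intro subsetD[OF closure_of_subset]) (auto simp: C_top_def)

text \<open>Evaluation at a point is continuous for pointwise convergence, so it carries the closure
  of a set of maps into the closure of its values.\<close>

lemma Ellis_eval_in_closure:
  assumes "is_completion \<iota>" "f \<in> Ellis \<iota>"
  shows "f (\<iota> x) \<in> closure {\<iota> (g x) | g. g \<in> Iso}"
proof -
  have "(\<lambda>f. f (\<iota> x)) ` closure (completion_ext \<iota> ` Iso) \<subseteq> closure {\<iota> (g x) | g. g \<in> Iso}"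
  proof (rule image_closure_subset)
    show "continuous_on (closure (completion_ext \<iota> ` Iso)) (\<lambda>f. f (\<iota> x))"
      by (rule continuous_on_subset[OF continuous_on_product_coordinates]) simp
    show "(\<lambda>f. f (\<iota> x)) ` completion_ext \<iota> ` Iso \<subseteq> closure {\<iota> (g x) | g. g \<in> Iso}"
      using completion_ext_props(2)[OF assms(1)]
      by (intro order_trans[OF _ closure_subset]) auto
  qed simp
  then show ?thesis using Ellis_subset_closure assms(2) by blast
qed

lemma limit_maps_subset_Ellis:
  assumes "is_completion \<iota>"
  shows "limit_maps \<iota> \<subseteq> Ellis \<iota>"
proof
  fix h assume "h \<in> limit_maps \<iota>"
  then obtain g where g: "range g \<subseteq> Iso" "limitin C_top (\<lambda>n. completion_ext \<iota> (g n)) h sequentially"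
    unfolding limit_maps_def by blast
  show "h \<in> Ellis \<iota>"
  proof (rule limitin_closedin[OF g(2)])
    show "closedin C_top (Ellis \<iota>)" unfolding Ellis_def by (rule closedin_closure_of)
    show "\<forall>\<^sub>F n in sequentially. completion_ext \<iota> (g n) \<in> Ellis \<iota>"
      using g(1) completion_ext_in_Ellis[OF assms] by (auto intro: always_eventually)
  qed simp
qed

section \<open>Pointwise limits of sequences of isometries\<close>

lemma cauchy_net_sequentially: "cauchy_net UNIV (\<le>) z \<longleftrightarrow> Cauchy (z :: nat \<Rightarrow> 'a::metric_space)"
  unfolding cauchy_net_def Cauchy_def by simp metis

lemma directed_nat: "directed UNIV ((\<le>) :: nat \<Rightarrow> nat \<Rightarrow> bool)"
  unfolding directed_def by (auto simp: reflp_on_def transp_on_def intro: max.cobounded1 max.cobounded2)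

text \<open>A cluster point \<open>l\<close> of the maps makes \<open>l x\<close> a cluster point of
  the values, and a Cauchy sequence converges to any of its cluster points.\<close>

lemma not_tends_to_infinity_eval:
  fixes g :: "nat \<Rightarrow> 'a::metric_space \<Rightarrow> 'a"
  assumes "\<not> tends_to_infinity (top_of_set G) UNIV (\<le>) g" "Cauchy (\<lambda>n. g n x)"
  obtains l where "l \<in> G" "(\<lambda>n. g n x) \<longlonglongrightarrow> l x"
proof -
  obtain l where l: "l \<in> G"
    and cl: "\<And>U i. openin (top_of_set G) U \<Longrightarrow> l \<in> U \<Longrightarrow> \<exists>j\<ge>i. g j \<in> U"
    using assms(1) unfolding tends_to_infinity_iff_no_cluster_point[OF directed_nat] by auto
  have "(\<lambda>n. g n x) \<longlonglongrightarrow> l x"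
    unfolding lim_sequentially
  proof (intro allI impI)
    fix e :: real assume e: "0 < e"
    then obtain N where N: "\<And>m n. N \<le> m \<Longrightarrow> N \<le> n \<Longrightarrow> dist (g m x) (g n x) < e / 2"
      using assms(2) unfolding Cauchy_def by (meson half_gt_zero)
    have "open ((\<lambda>f. f x) -` ball (l x) (e / 2))"
      by (intro open_vimage continuous_on_product_coordinates) simp
    then have "openin (top_of_set G) (G \<inter> (\<lambda>f. f x) -` ball (l x) (e / 2))"
      by (simp add: openin_open_Int)
    then obtain j where j: "N \<le> j" "dist (l x) (g j x) < e / 2"
      using cl[of _ N] l e by fastforce
    have "dist (g n x) (l x) < e" if "N \<le> n" for n
    proof -
      have "dist (g n x) (l x) \<le> dist (g n x) (g j x) + dist (l x) (g j x)" by (rule dist_triangle2)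
      then show ?thesis using N[OF that j(1)] j(2) by linarith
    qed
    then show "\<exists>N. \<forall>n\<ge>N. dist (g n x) (l x) < e" by blast
  qed
  with l that show ?thesis by blast
qed

text \<open>Isometries are equicontinuous, so a three-epsilon estimate transfers the Cauchy property
  from a nearby point of \<open>A\<close>.\<close>

lemma Cauchy_extends_to_closure:
  fixes f :: "nat \<Rightarrow> 'b::metric_space \<Rightarrow> 'c::metric_space"
  assumes iso: "\<And>n u v. dist (f n u) (f n v) = dist u v"
    and Cauchy: "\<And>u. u \<in> A \<Longrightarrow> Cauchy (\<lambda>n. f n u)"
    and "v \<in> closure A"
  shows "Cauchy (\<lambda>n. f n v)"
  unfolding Cauchy_def
proof (intro allI impI)
  fix e :: real assume "0 < e"
  then obtain u where u: "u \<in> A" "dist u v < e / 3"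
    using \<open>v \<in> closure A\<close> unfolding closure_approachable by (metis divide_pos_pos zero_less_numeral)
  then obtain N where N: "\<And>m n. N \<le> m \<Longrightarrow> N \<le> n \<Longrightarrow> dist (f m u) (f n u) < e / 3"
    using Cauchy \<open>0 < e\<close> unfolding Cauchy_def by (meson divide_pos_pos zero_less_numeral)
  have "dist (f m v) (f n v) < e" if "N \<le> m" "N \<le> n" for m n
  proof -
    have "dist (f m v) (f n v) \<le> dist (f m u) (f m v) + dist (f m u) (f n u) + dist (f n u) (f n v)"
      by (smt (verit) dist_commute dist_triangle)
    then show ?thesis using N[OF that] u(2) by (simp add: iso)
  qed
  then show "\<exists>M. \<forall>m\<ge>M. \<forall>n\<ge>M. dist (f m v) (f n v) < e" by blast
qed

lemma limitin_C_top:
  assumes "\<And>n. continuous_on UNIV (f n)" "continuous_on UNIV h" "\<And>u. (\<lambda>n. f n u) \<longlonglongrightarrow> h u"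
  shows "limitin C_top f h sequentially"
proof -
  have "limitin euclidean f h sequentially"
    using assms(3) by (simp add: limitin_componentwise flip: euclidean_product_topology)
  then show ?thesis
    using assms(1,2) by (simp add: C_top_def limitin_subtopology)
qed

section \<open>Orbit closures as Ellis orbits\<close>

lemma closure_Iso_orbit:
  fixes \<iota> :: "'a::metric_space \<Rightarrow> 'b::complete_space"
  assumes compl: "is_completion \<iota>" and ind: "cauchy_indivisible (Iso :: ('a \<Rightarrow> 'a) set)"
    and v: "v \<in> closure {\<iota> (g x) | g. g \<in> Iso}"
  shows "(\<exists>g\<in>Iso. v = \<iota> (g x)) \<or> (\<exists>h\<in>limit_maps \<iota>. v = h (\<iota> x))"
proof -
  have iso: "dist (\<iota> y) (\<iota> z) = dist y z" for y z
    using compl by (simp add: is_completion_def)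
  obtain w where w: "\<And>n. w n \<in> {\<iota> (g x) | g. g \<in> Iso}" "w \<longlonglongrightarrow> v"
    using v unfolding closure_sequential by blast
  then have "\<forall>n. \<exists>g. g \<in> Iso \<and> w n = \<iota> (g x)" by blast
  then obtain g where g: "\<And>n. g n \<in> Iso" "\<And>n. w n = \<iota> (g n x)" by metis
  have \<iota>_Cauchy: "Cauchy (\<lambda>n. \<iota> (z n)) \<longleftrightarrow> Cauchy z" for z :: "nat \<Rightarrow> 'a"
    by (simp add: Cauchy_def iso)
  have lim: "(\<lambda>n. \<iota> (g n x)) \<longlonglongrightarrow> v" using w(2) by (simp flip: g(2))
  then have Cauchy: "Cauchy (\<lambda>n. g n x)" using LIMSEQ_imp_Cauchy \<iota>_Cauchy by blast
  show ?thesis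
  proof (cases "tends_to_infinity (top_of_set Iso) UNIV (\<le>) g")
    case False
    then obtain l where l: "l \<in> Iso" "(\<lambda>n. g n x) \<longlonglongrightarrow> l x"
      using not_tends_to_infinity_eval Cauchy by blast
    then have "(\<lambda>n. \<iota> (g n x)) \<longlonglongrightarrow> \<iota> (l x)"
      by (simp add: lim_sequentially iso)
    then show ?thesis using l(1) lim LIMSEQ_unique by blast
  next
    case True
    have "Cauchy (\<lambda>n. g n y)" for y
      using cauchy_indivisible_net[OF ind directed_nat _ True, of x y] Cauchy g(1)
      by (auto simp: cauchy_net_sequentially)
    then have Cauchy_ext: "Cauchy (\<lambda>n. completion_ext \<iota> (g n) u)" if "u \<in> range \<iota>" for u
      using that by (auto simp: completion_ext_props(2)[OF compl g(1)] \<iota>_Cauchy)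
    \<comment> \<open>Cauchy-indivisibility gives the Cauchy property on the image of X only;
      density and the isometry property extend it to the whole completion, where these limits
      exist.\<close>
    define h where "h u = lim (\<lambda>n. completion_ext \<iota> (g n) u)" for u
    have "Cauchy (\<lambda>n. completion_ext \<iota> (g n) u)" for u
      by (rule Cauchy_extends_to_closure[where A = "range \<iota>"])
        (use compl Cauchy_ext completion_ext_isometric[OF compl g(1)] in \<open>auto simp: is_completion_def\<close>)
    then have h: "(\<lambda>n. completion_ext \<iota> (g n) u) \<longlonglongrightarrow> h u" for u
      unfolding h_def by (intro convergent_LIMSEQ_iff[THEN iffD1] Cauchy_convergent)
    \<comment> \<open>The limit map inherits the isometry property, which supplies the continuity
      needed for convergence in \<open>C_top\<close>.\<close>
    have "dist (h u) (h u') = dist u u'" for u u'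
      using LIMSEQ_unique[OF tendsto_dist[OF h h]] completion_ext_isometric[OF compl g(1)] by simp
    then have "continuous_on UNIV h"
      unfolding continuous_on_iff by auto
    then have "limitin C_top (\<lambda>n. completion_ext \<iota> (g n)) h sequentially"
      using h completion_ext_props(1)[OF compl g(1)] by (intro limitin_C_top)
    then have "h \<in> limit_maps \<iota>"
      unfolding limit_maps_def using g(1) True by blast
    moreover have "v = h (\<iota> x)"
      using LIMSEQ_unique[OF lim] h[of "\<iota> x"] by (simp add: completion_ext_props(2)[OF compl g(1)])
    ultimately show ?thesis by blast
  qed
qed

lemma Ellis_orbit_eq_closure:
  fixes \<iota> :: "'a::metric_space \<Rightarrow> 'b::complete_space"
  assumes compl: "is_completion \<iota>" and ind: "cauchy_indivisible (Iso :: ('a \<Rightarrow> 'a) set)"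
  shows "{f (\<iota> x) | f. f \<in> Ellis \<iota>} = closure {\<iota> (g x) | g. g \<in> Iso}"
proof
  show "{f (\<iota> x) | f. f \<in> Ellis \<iota>} \<subseteq> closure {\<iota> (g x) | g. g \<in> Iso}"
    using Ellis_eval_in_closure[OF compl] by blast
  show "closure {\<iota> (g x) | g. g \<in> Iso} \<subseteq> {f (\<iota> x) | f. f \<in> Ellis \<iota>}"
  proof
    fix v assume "v \<in> closure {\<iota> (g x) | g. g \<in> Iso}"
    from closure_Iso_orbit[OF compl ind this]
    show "v \<in> {f (\<iota> x) | f. f \<in> Ellis \<iota>}"
    proof (elim disjE bexE)
      fix g assume g: "g \<in> (Iso :: ('a \<Rightarrow> 'a) set)" "v = \<iota> (g x)"
      then have "v = completion_ext \<iota> g (\<iota> x)" by (simp add: completion_ext_props(2)[OF compl])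
      then show ?thesis using completion_ext_in_Ellis[OF compl g(1)] by blast
    next
      fix h assume "h \<in> limit_maps \<iota>" "v = h (\<iota> x)"
      then show ?thesis using limit_maps_subset_Ellis[OF compl] by blast
    qed
  qed
qed

text \<open>In this form invariance under E is closure under composition, and every point of the
  space lies on the orbit of a point of X.\<close>

lemma range_Un_limit_points_eq:
  fixes \<iota> :: "'a::metric_space \<Rightarrow> 'b::complete_space"
  assumes compl: "is_completion \<iota>" and ind: "cauchy_indivisible (Iso :: ('a \<Rightarrow> 'a) set)"
    and id: "id \<in> Ellis \<iota>"
  shows "range \<iota> \<union> limit_points \<iota> = {f (\<iota> x) | f x. f \<in> Ellis \<iota>}"
proof
  have "\<iota> x \<in> {f (\<iota> x) | f x. f \<in> Ellis \<iota>}" for x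
    using id by (metis (mono_tags, lifting) id_apply mem_Collect_eq)
  then show "range \<iota> \<union> limit_points \<iota> \<subseteq> {f (\<iota> x) | f x. f \<in> Ellis \<iota>}"
    using limit_maps_subset_Ellis[OF compl] by (auto simp: limit_points_def)
  show "{f (\<iota> x) | f x. f \<in> Ellis \<iota>} \<subseteq> range \<iota> \<union> limit_points \<iota>"
  proof safe
    fix f x assume "f \<in> Ellis \<iota>" "f (\<iota> x) \<notin> limit_points \<iota>"
    then show "f (\<iota> x) \<in> range \<iota>"
      using closure_Iso_orbit[OF compl ind Ellis_eval_in_closure[OF compl]]
      unfolding limit_points_def by blast
  qed
qed

section \<open>Applying the section construction to the Ellis group\<close>

theorem proposition7p1:
  fixes \<iota> :: "'a::metric_space \<Rightarrow> 'b::complete_space"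
  assumes "is_completion \<iota>"
    and "separable_space (euclidean :: 'a topology)"
    and "cauchy_indivisible (Iso :: ('a \<Rightarrow> 'a) set)"
    and "group (Ellis_monoid \<iota>)"
  shows "\<exists>S. is_borel_section (Ellis \<iota>) (range \<iota> \<union> limit_points \<iota>) S"
proof -
  interpret E: group "Ellis_monoid \<iota>" by (rule assms(4))
  have id: "id \<in> Ellis \<iota>"
    using E.one_closed by (simp add: Ellis_monoid_def)
  have comp: "f \<circ> g \<in> Ellis \<iota>" if "f \<in> Ellis \<iota>" "g \<in> Ellis \<iota>" for f g
    using E.m_closed[of f g] that by (simp add: Ellis_monoid_def)
  have inv: "\<exists>g\<in>Ellis \<iota>. g \<circ> f = id" if "f \<in> Ellis \<iota>" for f
    using E.l_inv_ex[of f] that by (simp add: Ellis_monoid_def)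
  have orb_eq: "{h (f y) | h. h \<in> Ellis \<iota>} = {h y | h. h \<in> Ellis \<iota>}" if f: "f \<in> Ellis \<iota>" for f y
  proof safe
    fix h assume "h \<in> Ellis \<iota>"
    then show "\<exists>h'. h (f y) = h' y \<and> h' \<in> Ellis \<iota>"
      using comp[OF _ f] by (intro exI[of _ "h \<circ> f"]) simp
    \<comment> \<open>The group hypothesis yields the reverse inclusion: a left inverse
      \<open>g\<close> of \<open>f\<close> leads from \<open>f y\<close> back to
      \<open>y\<close>.\<close>
    obtain g where g: "g \<in> Ellis \<iota>" "g \<circ> f = id" using inv[OF f] by blast
    then have "h y = (h \<circ> g) (f y)" by (metis comp_apply id_apply)
    then show "\<exists>h'. h y = h' (f y) \<and> h' \<in> Ellis \<iota>"
      using comp[OF \<open>h \<in> Ellis \<iota>\<close> g(1)] by blast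
  qed
  note Y_eq = range_Un_limit_points_eq[OF assms(1,3) id]
  obtain C where C: "countable C" "closure C = (UNIV :: 'a set)"
    using assms(2) unfolding separable_space_def by auto
  \<comment> \<open>A countable dense subset of X is carried into the completion, where it stays
    dense; \<open>from_nat_into\<close> enumerates it, possibly with repetitions, once it is
    nonempty.\<close>
  define q where "q = \<iota> \<circ> from_nat_into C"
  have "C \<noteq> {}" using C(2) by auto
  have "continuous_on UNIV \<iota>"
    using assms(1) unfolding continuous_on_iff is_completion_def by auto
  then have "\<iota> ` closure C \<subseteq> closure (\<iota> ` C)"
    using C(2) by (intro image_closure_subset closure_subset closed_closure) simp
  then have "closure (range \<iota>) \<subseteq> closure (\<iota> ` C)"
    using C(2) by (intro closure_minimal) auto
  moreover have "range q = \<iota> ` C"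
    using range_from_nat_into[OF \<open>C \<noteq> {}\<close> C(1)] unfolding q_def by (metis image_comp)
  ultimately have dense: "closure (range q) = UNIV"
    using assms(1) by (auto simp: is_completion_def)
  show ?thesis
  proof (rule ex_borel_section[where q = q])
    fix f assume f: "f \<in> Ellis \<iota>"
    show "continuous_on (range \<iota> \<union> limit_points \<iota>) f"
      using Ellis_continuous[OF f] continuous_on_subset by blast
    fix y assume "y \<in> range \<iota> \<union> limit_points \<iota>"
    then obtain h x where "h \<in> Ellis \<iota>" "y = h (\<iota> x)" unfolding Y_eq by blast
    then have "f y = (f \<circ> h) (\<iota> x)" "f \<circ> h \<in> Ellis \<iota>" using comp[OF f] by auto
    then show "f y \<in> range \<iota> \<union> limit_points \<iota>" unfolding Y_eq by blast
  next
    fix y assume "y \<in> range \<iota> \<union> limit_points \<iota>"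
    then obtain h x where h: "h \<in> Ellis \<iota>" "y = h (\<iota> x)" unfolding Y_eq by blast
    show "complete {h y | h. h \<in> Ellis \<iota>}"
      \<comment> \<open>The orbit of \<open>h (\<iota> x)\<close> equals that of
        \<open>\<iota> x\<close>, which is a closure and so closed in a complete space.\<close>
      unfolding h(2) orb_eq[OF h(1)] Ellis_orbit_eq_closure[OF assms(1,3)]
      by (simp add: complete_eq_closed)
  qed (use id orb_eq dense in auto)
qed

end
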